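(* Let $S$ be a Po-$\Gamma$-semigroup and let $A$ be a non-empty subset of $S$. Then $A$ is a characteristic interior ideal of $S$ if and only if its characteristic function $\chi_A : S \to [0,1]$ (with $\chi_A(x) = 1$ if $x \in A$ and $\chi_A(x) = 0$ if $x \notin A$) is a fuzzy characteristic interior ideal of $S$.
   Context: Let $S$ and $\Gamma$ be non-empty sets. $S$ is called a $\Gamma$-semigroup if there is a mapping $S \times \Gamma \times S \to S$, written $(a,\alpha,b) \mapsto a\alpha b$, satisfying $(a\alpha b)\beta c = a\alpha(b\beta c)$ for all $a,b,c \in S$ and all $\alpha,\beta \in \Gamma$. A Po-$\Gamma$-semigroup (partially ordered $\Gamma$-semigroup) is a $\Gamma$-semigroup $S$ equipped with a partial order $\leq$ such that for all $a,b,c \in S$ and $\gamma \in \Gamma$, $a \leq b$ implies $a\gamma c \leq b\gamma c$ and $c\gamma a \leq c\gamma b$. For subsets $A, B$ of $S$, $A\Gamma B = \{a\gamma b : a \in A, \gamma \in \Gamma, b \in B\}$. A subsemigroup of $S$ is a non-empty subset $A \subseteq S$ with $A\Gamma A \subseteq A$. A subsemigroup $A$ of $S$ is an interior ideal of $S$ if (1) $S\Gamma A\Gamma S \subseteq A$, and (2) $a \in A$, $b \in S$ and $b \leq a$ imply $b \in A$. A fuzzy subset of a set $X$ is a function $\mu : X \to [0,1]$; it is non-empty if it is not identically $0$. A non-empty fuzzy subset $\mu$ of $S$ is a fuzzy subsemigroup of $S$ if $\mu(x\gamma y) \geq \min\{\mu(x),\mu(y)\}$ for all $x,y \in S$ and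 $\gamma \in \Gamma$. A fuzzy subsemigroup $\mu$ of $S$ is a fuzzy interior ideal of $S$ if (1) $\mu(x\alpha a\beta y) \geq \mu(a)$ for all $x,a,y \in S$ and $\alpha,\beta \in \Gamma$, and (2) $x \leq y$ implies $\mu(x) \geq \mu(y)$ for all $x,y \in S$. $\mathrm{Aut}(S)$ denotes the set of all automorphisms of the Po-$\Gamma$-semigroup $S$, i.e. bijections $f : S \to S$ with $f(a\gamma b) = f(a)\gamma f(b)$ for all $a,b \in S$, $\gamma \in \Gamma$, and $a \leq b$ if and only if $f(a) \leq f(b)$. An interior ideal $A$ of $S$ is a characteristic interior ideal if $f(A) = A$ for all $f \in \mathrm{Aut}(S)$. A fuzzy interior ideal $\mu$ of $S$ is a fuzzy characteristic interior ideal if $\mu(f(x)) = \mu(x)$ for all $x \in S$ and all $f \in \mathrm{Aut}(S)$. *)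

theory Defs
  imports Complex_Main "HOL-Library.FuncSet" "HOL-Library.Indicator_Function"
begin

text \<open>
  \<open>S\<close> and \<open>\<Gamma>\<close> are carrier sets, \<open>mul a \<gamma> b\<close> is the product \<open>a\<gamma>b\<close>, and \<open>r\<close> is the order on \<open>S\<close>,
  with \<open>(a, b) \<in> r\<close> meaning \<open>a \<le> b\<close>; the library predicate \<^const>\<open>partial_order_on\<close> includes
  \<open>r \<subseteq> S \<times> S\<close>.
\<close>

locale gamma_semigroup =
  fixes S :: "'a set" and \<Gamma> :: "'g set" and mul :: "'a \<Rightarrow> 'g \<Rightarrow> 'a \<Rightarrow> 'a"
  assumes carrier_nonempty: "S \<noteq> {}"
    and gamma_nonempty: "\<Gamma> \<noteq> {}"
    and mul_closed: "\<lbrakk>a \<in> S; \<gamma> \<in> \<Gamma>; b \<in> S\<rbrakk> \<Longrightarrow> mul a \<gamma> b \<in> S"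
    and mul_assoc: "\<lbrakk>a \<in> S; b \<in> S; c \<in> S; \<alpha> \<in> \<Gamma>; \<beta> \<in> \<Gamma>\<rbrakk> \<Longrightarrow>
      mul (mul a \<alpha> b) \<beta> c = mul a \<alpha> (mul b \<beta> c)"

locale po_gamma_semigroup = gamma_semigroup S \<Gamma> mul
  for S :: "'a set" and \<Gamma> :: "'g set" and mul :: "'a \<Rightarrow> 'g \<Rightarrow> 'a \<Rightarrow> 'a" +
  fixes r :: "('a \<times> 'a) set"
  assumes order: "partial_order_on S r"
    and mul_mono_left: "\<lbrakk>a \<in> S; b \<in> S; c \<in> S; \<gamma> \<in> \<Gamma>; (a, b) \<in> r\<rbrakk> \<Longrightarrow> (mul a \<gamma> c, mul b \<gamma> c) \<in> r"
    and mul_mono_right: "\<lbrakk>a \<in> S; b \<in> S; c \<in> S; \<gamma> \<in> \<Gamma>; (a, b) \<in> r\<rbrakk> \<Longrightarrow> (mul c \<gamma> a, mul c \<gamma> b) \<in> r"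

definition set_mul :: "'g set \<Rightarrow> ('a \<Rightarrow> 'g \<Rightarrow> 'a \<Rightarrow> 'a) \<Rightarrow> 'a set \<Rightarrow> 'a set \<Rightarrow> 'a set" where
  "set_mul \<Gamma> mul A B = {mul a \<gamma> b | a \<gamma> b. a \<in> A \<and> \<gamma> \<in> \<Gamma> \<and> b \<in> B}"

definition subsemigroup :: "'a set \<Rightarrow> 'g set \<Rightarrow> ('a \<Rightarrow> 'g \<Rightarrow> 'a \<Rightarrow> 'a) \<Rightarrow> 'a set \<Rightarrow> bool" where
  "subsemigroup S \<Gamma> mul A \<longleftrightarrow> A \<noteq> {} \<and> A \<subseteq> S \<and> set_mul \<Gamma> mul A A \<subseteq> A"

definition interior_ideal ::
    "'a set \<Rightarrow> 'g set \<Rightarrow> ('a \<Rightarrow> 'g \<Rightarrow> 'a \<Rightarrow> 'a) \<Rightarrow> ('a \<times> 'a) set \<Rightarrow> 'a set \<Rightarrow> bool" where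
  "interior_ideal S \<Gamma> mul r A \<longleftrightarrow>
     subsemigroup S \<Gamma> mul A \<and>
     set_mul \<Gamma> mul (set_mul \<Gamma> mul S A) S \<subseteq> A \<and>
     (\<forall>a\<in>A. \<forall>b\<in>S. (b, a) \<in> r \<longrightarrow> b \<in> A)"

text \<open>
  A fuzzy subset of \<open>S\<close> is represented by a real-valued function on the ambient type, of which only
  the values on \<open>S\<close> matter.
\<close>

definition fuzzy_subset :: "'a set \<Rightarrow> ('a \<Rightarrow> real) \<Rightarrow> bool" where
  "fuzzy_subset X \<mu> \<longleftrightarrow> \<mu> \<in> X \<rightarrow> {0..1}"

definition fuzzy_nonempty :: "'a set \<Rightarrow> ('a \<Rightarrow> real) \<Rightarrow> bool" where
  "fuzzy_nonempty X \<mu> \<longleftrightarrow> \<not> (\<forall>x\<in>X. \<mu> x = 0)"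

definition fuzzy_subsemigroup ::
    "'a set \<Rightarrow> 'g set \<Rightarrow> ('a \<Rightarrow> 'g \<Rightarrow> 'a \<Rightarrow> 'a) \<Rightarrow> ('a \<Rightarrow> real) \<Rightarrow> bool" where
  "fuzzy_subsemigroup S \<Gamma> mul \<mu> \<longleftrightarrow>
     fuzzy_subset S \<mu> \<and> fuzzy_nonempty S \<mu> \<and>
     (\<forall>x\<in>S. \<forall>y\<in>S. \<forall>\<gamma>\<in>\<Gamma>. \<mu> (mul x \<gamma> y) \<ge> min (\<mu> x) (\<mu> y))"

definition fuzzy_interior_ideal ::
    "'a set \<Rightarrow> 'g set \<Rightarrow> ('a \<Rightarrow> 'g \<Rightarrow> 'a \<Rightarrow> 'a) \<Rightarrow> ('a \<times> 'a) set \<Rightarrow> ('a \<Rightarrow> real) \<Rightarrow> bool" where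
  "fuzzy_interior_ideal S \<Gamma> mul r \<mu> \<longleftrightarrow>
     fuzzy_subsemigroup S \<Gamma> mul \<mu> \<and>
     (\<forall>x\<in>S. \<forall>a\<in>S. \<forall>y\<in>S. \<forall>\<alpha>\<in>\<Gamma>. \<forall>\<beta>\<in>\<Gamma>. \<mu> (mul (mul x \<alpha> a) \<beta> y) \<ge> \<mu> a) \<and>
     (\<forall>x\<in>S. \<forall>y\<in>S. (x, y) \<in> r \<longrightarrow> \<mu> x \<ge> \<mu> y)"

text \<open>
  Automorphisms are taken in the extensional function space, so that each bijection of \<open>S\<close> has
  exactly one representative.
\<close>

definition Aut ::
    "'a set \<Rightarrow> 'g set \<Rightarrow> ('a \<Rightarrow> 'g \<Rightarrow> 'a \<Rightarrow> 'a) \<Rightarrow> ('a \<times> 'a) set \<Rightarrow> ('a \<Rightarrow> 'a) set" where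
  "Aut S \<Gamma> mul r =
     {f \<in> S \<rightarrow>\<^sub>E S. bij_betw f S S \<and>
        (\<forall>a\<in>S. \<forall>b\<in>S. \<forall>\<gamma>\<in>\<Gamma>. f (mul a \<gamma> b) = mul (f a) \<gamma> (f b)) \<and>
        (\<forall>a\<in>S. \<forall>b\<in>S. (a, b) \<in> r \<longleftrightarrow> (f a, f b) \<in> r)}"

definition characteristic_interior_ideal ::
    "'a set \<Rightarrow> 'g set \<Rightarrow> ('a \<Rightarrow> 'g \<Rightarrow> 'a \<Rightarrow> 'a) \<Rightarrow> ('a \<times> 'a) set \<Rightarrow> 'a set \<Rightarrow> bool" where
  "characteristic_interior_ideal S \<Gamma> mul r A \<longleftrightarrow>
     interior_ideal S \<Gamma> mul r A \<and> (\<forall>f\<in>Aut S \<Gamma> mul r. f ` A = A)"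

definition fuzzy_characteristic_interior_ideal ::
    "'a set \<Rightarrow> 'g set \<Rightarrow> ('a \<Rightarrow> 'g \<Rightarrow> 'a \<Rightarrow> 'a) \<Rightarrow> ('a \<times> 'a) set \<Rightarrow> ('a \<Rightarrow> real) \<Rightarrow> bool" where
  "fuzzy_characteristic_interior_ideal S \<Gamma> mul r \<mu> \<longleftrightarrow>
     fuzzy_interior_ideal S \<Gamma> mul r \<mu> \<and>
     (\<forall>x\<in>S. \<forall>f\<in>Aut S \<Gamma> mul r. \<mu> (f x) = \<mu> x)"

end

theory Submission
  imports Defs
begin

lemma indicator_le_indicator_iff:
  "(indicator A x :: real) \<le> indicator A y \<longleftrightarrow> (x \<in> A \<longrightarrow> y \<in> A)"
  by (simp add: indicator_def)

lemma min_indicator_le_indicator_iff: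
  "min (indicator A x) (indicator A y) \<le> (indicator A z :: real) \<longleftrightarrow> (x \<in> A \<and> y \<in> A \<longrightarrow> z \<in> A)"
  by (auto simp: indicator_def)

lemma indicator_eq_indicator_iff:
  "(indicator A x :: real) = indicator A y \<longleftrightarrow> (x \<in> A \<longleftrightarrow> y \<in> A)"
  by (simp add: indicator_def)

lemma ball_set_mul:
  "(\<forall>x\<in>set_mul \<Gamma> mul A B. P x) \<longleftrightarrow> (\<forall>a\<in>A. \<forall>\<gamma>\<in>\<Gamma>. \<forall>b\<in>B. P (mul a \<gamma> b))"
  by (auto simp: set_mul_def)

lemma fuzzy_subsemigroup_indicator_iff:
  assumes "A \<subseteq> S" and "A \<noteq> {}"
  shows "fuzzy_subsemigroup S \<Gamma> mul (indicator A) \<longleftrightarrow> subsemigroup S \<Gamma> mul A"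
proof -
  have "fuzzy_subset S (indicator A)"
    by (simp add: fuzzy_subset_def indicator_def)
  \<comment> \<open>A point of \<open>A\<close> lies in \<open>S\<close>, and the indicator is 1
    there.\<close>
  moreover have "fuzzy_nonempty S (indicator A)"
    using assms by (auto simp: fuzzy_nonempty_def indicator_def)
  \<comment> \<open>Bounds over \<open>S\<close> guarded by membership in \<open>A\<close> shrink to
    bounds over \<open>A\<close>. Keeping \<open>P\<close> arbitrary makes this a rewrite rule for
    the closing \<open>simp only\<close>.\<close>
  moreover have "(\<forall>x\<in>S. \<forall>y\<in>S. \<forall>\<gamma>\<in>\<Gamma>. x \<in> A \<and> y \<in> A \<longrightarrow> P x \<gamma> y) \<longleftrightarrow>
      (\<forall>x\<in>A. \<forall>\<gamma>\<in>\<Gamma>. \<forall>y\<in>A. P x \<gamma> y)" for P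
    using assms(1) by blast
  ultimately show ?thesis
    using assms
    by (simp only: fuzzy_subsemigroup_def subsemigroup_def subset_eq[of "set_mul _ _ _ _"]
        ball_set_mul min_indicator_le_indicator_iff simp_thms)
qed

lemma fuzzy_interior_ideal_indicator_iff:
  assumes "A \<subseteq> S" and "A \<noteq> {}"
  shows "fuzzy_interior_ideal S \<Gamma> mul r (indicator A) \<longleftrightarrow> interior_ideal S \<Gamma> mul r A"
proof -
  \<comment> \<open>Only the middle factor is guarded by \<open>A\<close>; the quantifiers are also
    reordered to match what \<open>ball_set_mul\<close> yields for the nested product.\<close>
  have "(\<forall>x\<in>S. \<forall>a\<in>S. \<forall>y\<in>S. \<forall>\<alpha>\<in>\<Gamma>. \<forall>\<beta>\<in>\<Gamma>. a \<in> A \<longrightarrow> P x \<alpha> a \<beta> y) \<longleftrightarrow>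
      (\<forall>x\<in>S. \<forall>\<alpha>\<in>\<Gamma>. \<forall>a\<in>A. \<forall>\<beta>\<in>\<Gamma>. \<forall>y\<in>S. P x \<alpha> a \<beta> y)" for P
    using assms(1) by blast
  moreover have "(\<forall>x\<in>S. \<forall>y\<in>S. (x, y) \<in> r \<longrightarrow> y \<in> A \<longrightarrow> x \<in> A) \<longleftrightarrow>
      (\<forall>a\<in>A. \<forall>b\<in>S. (b, a) \<in> r \<longrightarrow> b \<in> A)"
    using assms(1) by blast
  ultimately show ?thesis
    by (simp only: fuzzy_interior_ideal_def interior_ideal_def
        fuzzy_subsemigroup_indicator_iff[OF assms] subset_eq[of "set_mul _ _ _ _"]
        ball_set_mul indicator_le_indicator_iff)
qed

lemma bij_betw_image_eq_iff:
  assumes "bij_betw f S S" and "A \<subseteq> S"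
  shows "f ` A = A \<longleftrightarrow> (\<forall>x\<in>S. f x \<in> A \<longleftrightarrow> x \<in> A)"
proof
  assume "f ` A = A"
  moreover have "f x \<in> f ` A \<longleftrightarrow> x \<in> A" if "x \<in> S" for x
    using bij_betw_imp_inj_on[OF assms(1)] that assms(2) by (rule inj_on_image_mem_iff)
  ultimately show "\<forall>x\<in>S. f x \<in> A \<longleftrightarrow> x \<in> A"
    by simp
next
  assume *: "\<forall>x\<in>S. f x \<in> A \<longleftrightarrow> x \<in> A"
  show "f ` A = A"
  proof
    show "f ` A \<subseteq> A"
      using * assms(2) by auto
    show "A \<subseteq> f ` A"
    proof
      fix y assume "y \<in> A"
      then obtain x where "x \<in> S" "y = f x"
        using assms by (auto simp: bij_betw_def)
      then show "y \<in> f ` A"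
        using * \<open>y \<in> A\<close> by simp
    qed
  qed
qed

theorem theorem3p4:
  fixes S :: "'a set" and \<Gamma> :: "'g set" and mul :: "'a \<Rightarrow> 'g \<Rightarrow> 'a \<Rightarrow> 'a"
    and r :: "('a \<times> 'a) set" and A :: "'a set"
  assumes "po_gamma_semigroup S \<Gamma> mul r"
    and "A \<subseteq> S" and "A \<noteq> {}"
  shows "characteristic_interior_ideal S \<Gamma> mul r A \<longleftrightarrow>
    fuzzy_characteristic_interior_ideal S \<Gamma> mul r (indicator A :: 'a \<Rightarrow> real)"
proof -
  have "f ` A = A \<longleftrightarrow> (\<forall>x\<in>S. f x \<in> A \<longleftrightarrow> x \<in> A)" if "f \<in> Aut S \<Gamma> mul r" for f
    using that assms(2) by (intro bij_betw_image_eq_iff) (auto simp: Aut_def)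
  \<comment> \<open>The quantifiers over points and automorphisms are exchanged to agree with the
    fuzzy definition.\<close>
  then have "(\<forall>f\<in>Aut S \<Gamma> mul r. f ` A = A) \<longleftrightarrow>
      (\<forall>x\<in>S. \<forall>f\<in>Aut S \<Gamma> mul r. f x \<in> A \<longleftrightarrow> x \<in> A)"
    by auto
  then show ?thesis
    by (simp only: characteristic_interior_ideal_def fuzzy_characteristic_interior_ideal_def
        fuzzy_interior_ideal_indicator_iff[OF assms(2,3)] indicator_eq_indicator_iff)
qed

end
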